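(* Let $I\subset\mathbb{R}$ be an interval, let $a,b\in I$ with $a<b$, and let $f:I\to\mathbb{R}$ be twice differentiable on the interior $I^{\circ}$ of $I$, with $f''\in L_1[a,b]$. If $|f''|$ is convex on $[a,b]$, then $$\left|\frac{1}{b-a}\int_a^b f(x)\,dx-f\left(\frac{a+b}{2}\right)\right|\le \frac{(b-a)^2}{24}\left[\frac{|f''(a)|+|f''(b)|}{2}\right].$$
   Context: The hypotheses on $f''$ over $[a,b]$ presuppose that $f$ is twice differentiable at every point of $[a,b]$; if $a$ or $b$ is an endpoint of $I$, the derivatives $f'$ and $f''$ there are understood as one-sided derivatives. *)

theory Defs
  imports "HOL-Analysis.Analysis"
begin

end

theory Submission
  imports Defs
begin

text \<open>
  Put \<open>m = (a + b) / 2\<close>, \<open>h = (b - a) / 2\<close> and let \<open>F\<close> be an antiderivative of \<open>f\<close>. The function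
  \<open>t \<mapsto> F (m + t) - F (m - t) - 2 t f m\<close> vanishes at \<open>0\<close> with its first two derivatives, and its value at
  \<open>h\<close> is the midpoint rule error \<open>F b - F a - (b - a) f m\<close>. Its third derivative is \<open>f'' (m + t) + f'' (m - t)\<close>, which
  convexity bounds by \<open>\<bar>f'' a\<bar> + \<bar>f'' b\<bar>\<close>; integrating this bound three times gives
  the bound \<open>(\<bar>f'' a\<bar> + \<bar>f'' b\<bar>) h^3 / 6\<close> for the error.
\<close>

text \<open>The chord over \<open>{a..b}\<close> lies above \<open>\<phi>\<close> at
  \<open>x\<close> and at its mirror image \<open>a + b - x\<close>. Being affine, the chord has
  values at these two points that add up to \<open>\<phi> a + \<phi> b\<close>.\<close>

lemma convex_on_reflect_sum_le:
  fixes \<phi> :: "real \<Rightarrow> real"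
  assumes "convex_on {a..b} \<phi>" "x \<in> {a..b}"
  shows "\<phi> x + \<phi> (a + b - x) \<le> \<phi> a + \<phi> b"
proof (cases "a = b")
  case True
  then show ?thesis using assms by auto
next
  case False
  with assms have "b - a \<noteq> 0" by auto
  have "\<phi> x \<le> (\<phi> b - \<phi> a) / (b - a) * (x - a) + \<phi> a"
    by (rule convex_onD_Icc'[OF assms])
  moreover have "\<phi> (a + b - x) \<le> (\<phi> b - \<phi> a) / (b - a) * (a + b - x - a) + \<phi> a"
    using assms(2) by (intro convex_onD_Icc'[OF assms(1)]) auto
  moreover have "(\<phi> b - \<phi> a) / (b - a) * (x - a) + (\<phi> b - \<phi> a) / (b - a) * (a + b - x - a)
      = (\<phi> b - \<phi> a) / (b - a) * (b - a)"
    by (subst distrib_left[symmetric]) simp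
  ultimately show ?thesis using \<open>b - a \<noteq> 0\<close> by simp
qed

text \<open>The mean value inequality with a variable majorant; each use integrates a derivative
  bound once.\<close>

lemma abs_le_of_abs_derivative_le:
  fixes u v :: "real \<Rightarrow> real"
  assumes u: "\<And>s. s \<in> {0..h} \<Longrightarrow> (u has_real_derivative u' s) (at s within {0..h})"
    and v: "\<And>s. s \<in> {0..h} \<Longrightarrow> (v has_real_derivative v' s) (at s within {0..h})"
    and le: "\<And>s. s \<in> {0..h} \<Longrightarrow> \<bar>u' s\<bar> \<le> v' s"
    and "u 0 = 0" "v 0 = 0" "t \<in> {0..h}"
  shows "\<bar>u t\<bar> \<le> v t"
proof (cases "t = 0")
  case True
  then show ?thesis using assms by simp
next
  case False
  with \<open>t \<in> {0..h}\<close> have "0 < t" "t \<le> h" by auto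
  have cont: "continuous_on {0..t} w"
    if "\<And>s. s \<in> {0..h} \<Longrightarrow> (w has_real_derivative w' s) (at s within {0..h})" for w w'
    using DERIV_continuous_on[OF that] \<open>t \<le> h\<close> by (auto intro: continuous_on_subset)
  \<comment> \<open>The mean value inequality wants two-sided derivatives, but only at interior
    points, where \<open>at s within {0..h}\<close> equals \<open>at s\<close>.\<close>
  have inner: "(w has_vector_derivative w' s) (at s)"
    if "\<And>s. s \<in> {0..h} \<Longrightarrow> (w has_real_derivative w' s) (at s within {0..h})" "0 < s" "s < t"
    for w w' s
    using that(1)[of s] that(2,3) \<open>t \<le> h\<close>
    by (simp add: has_real_derivative_iff_has_vector_derivative at_within_Icc_at)
  have "norm (u t - u 0) \<le> v t - v 0"
    using \<open>t \<le> h\<close>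
    by (intro differentiable_bound_general[OF \<open>0 < t\<close> cont[OF u] cont[OF v] inner[OF u] inner[OF v]])
      (auto intro: le)
  then show ?thesis using assms by simp
qed

text \<open>Chain rule: both maps send \<open>{0..h}\<close> into \<open>{m-h..m+h}\<close>, so the
  derivative of \<open>g\<close> restricts to the image, one-sidedly at \<open>m\<close> and at the
  ends.\<close>

lemma DERIV_shift_reflect_within:
  fixes g :: "real \<Rightarrow> real"
  assumes g: "\<And>x. x \<in> {m-h..m+h} \<Longrightarrow> (g has_real_derivative g' x) (at x within {m-h..m+h})"
    and s: "s \<in> {0..h}"
  shows "((\<lambda>t. g (m + t)) has_real_derivative g' (m + s)) (at s within {0..h})"
    and "((\<lambda>t. g (m - t)) has_real_derivative - g' (m - s)) (at s within {0..h})"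
proof -
  have "(g has_real_derivative g' (m + s)) (at (m + s) within (\<lambda>t. m + t) ` {0..h})"
    using s by (intro DERIV_subset[OF g]) auto
  moreover have "((\<lambda>t. m + t) has_real_derivative 1) (at s within {0..h})"
    by (auto intro!: derivative_eq_intros)
  ultimately
  show "((\<lambda>t. g (m + t)) has_real_derivative g' (m + s)) (at s within {0..h})"
    using DERIV_image_chain by (fastforce simp: o_def)
  have "(g has_real_derivative g' (m - s)) (at (m - s) within (\<lambda>t. m - t) ` {0..h})"
    using s by (intro DERIV_subset[OF g]) auto
  moreover have "((\<lambda>t. m - t) has_real_derivative -1) (at s within {0..h})"
    by (auto intro!: derivative_eq_intros)
  ultimately
  show "((\<lambda>t. g (m - t)) has_real_derivative - g' (m - s)) (at s within {0..h})"
    using DERIV_image_chain by (fastforce simp: o_def)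
qed

text \<open>By symmetry about \<open>m\<close> the error depends only on the even part of
  \<open>f''\<close> there, so bounding the symmetric sum suffices. Successive integration turns
  \<open>C\<close> into \<open>C * t\<close>, \<open>C * t\<^sup>2 / 2\<close> and
  \<open>C * t ^ 3 / 6\<close>.\<close>

lemma midpoint_rule_error:
  fixes f f' f'' :: "real \<Rightarrow> real"
  assumes "0 \<le> h"
    and f: "\<And>x. x \<in> {m-h..m+h} \<Longrightarrow> (f has_real_derivative f' x) (at x within {m-h..m+h})"
    and f': "\<And>x. x \<in> {m-h..m+h} \<Longrightarrow> (f' has_real_derivative f'' x) (at x within {m-h..m+h})"
    and bound: "\<And>t. t \<in> {0..h} \<Longrightarrow> \<bar>f'' (m + t) + f'' (m - t)\<bar> \<le> C"
  shows "\<bar>integral {m-h..m+h} f - 2 * h * f m\<bar> \<le> C * h ^ 3 / 6"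
proof -
  define F where "F x = integral {m-h..x} f" for x
  have F: "(F has_real_derivative f x) (at x within {m-h..m+h})" if "x \<in> {m-h..m+h}" for x
    unfolding F_def using that
    by (intro integral_has_real_derivative DERIV_continuous_on[OF f])
  note derivs = DERIV_shift_reflect_within[OF F] DERIV_shift_reflect_within[OF f]
    DERIV_shift_reflect_within[OF f']
  have 1: "\<bar>f' (m + t) - f' (m - t)\<bar> \<le> C * t" if "t \<in> {0..h}" for t
  proof (rule abs_le_of_abs_derivative_le[OF _ _ bound _ _ that])
    fix s assume "s \<in> {0..h}"
    from DERIV_diff[OF derivs(5,6)[OF _ this]]
    show "((\<lambda>t. f' (m + t) - f' (m - t)) has_real_derivative f'' (m + s) + f'' (m - s))
        (at s within {0..h})"
      by simp
  qed (auto intro!: derivative_eq_intros)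
  \<comment> \<open>Subtracting \<open>2 * f m\<close> makes the left side vanish at
    \<open>0\<close>, as the comparison requires.\<close>
  have 2: "\<bar>f (m + t) + f (m - t) - 2 * f m\<bar> \<le> C * t\<^sup>2 / 2" if "t \<in> {0..h}" for t
  proof (rule abs_le_of_abs_derivative_le[OF _ _ 1 _ _ that])
    fix s assume "s \<in> {0..h}"
    from DERIV_diff[OF DERIV_add[OF derivs(3,4)[OF _ this]] DERIV_const]
    show "((\<lambda>t. f (m + t) + f (m - t) - 2 * f m) has_real_derivative f' (m + s) - f' (m - s))
        (at s within {0..h})"
      by simp
  qed (auto intro!: derivative_eq_intros)
  have "\<bar>F (m + h) - F (m - h) - 2 * h * f m\<bar> \<le> C * h ^ 3 / 6"
  proof (rule abs_le_of_abs_derivative_le[where t = h, OF _ _ 2])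
    fix s assume "s \<in> {0..h}"
    from DERIV_diff[OF DERIV_diff[OF derivs(1,2)[OF _ this]]
        DERIV_cmult[where c = "2 * f m", OF DERIV_ident]]
    show "((\<lambda>t. F (m + t) - F (m - t) - 2 * t * f m)
        has_real_derivative f (m + s) + f (m - s) - 2 * f m) (at s within {0..h})"
      by (simp add: mult_ac)
  qed (use \<open>0 \<le> h\<close> in \<open>auto intro!: derivative_eq_intros\<close>)
  \<comment> \<open>\<open>F (m - h)\<close> is an integral over a single point, hence
    \<open>0\<close>.\<close>
  then show ?thesis by (simp add: F_def)
qed

theorem theorem3:
  fixes I :: "real set" and a b :: real and f f' f'' :: "real \<Rightarrow> real"
  assumes "is_interval I"
    and "a \<in> I" and "b \<in> I" and "a < b"
    and "\<And>x. x \<in> interior I \<union> {a..b} \<Longrightarrow> (f has_real_derivative f' x) (at x within I)"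
    and "\<And>x. x \<in> interior I \<union> {a..b} \<Longrightarrow> (f' has_real_derivative f'' x) (at x within I)"
    and "f'' absolutely_integrable_on {a..b}"
    and "convex_on {a..b} (\<lambda>x. \<bar>f'' x\<bar>)"
  shows "\<bar>1 / (b - a) * integral {a..b} f - f ((a + b) / 2)\<bar>
           \<le> (b - a)\<^sup>2 / 24 * ((\<bar>f'' a\<bar> + \<bar>f'' b\<bar>) / 2)"
proof -
  define m h where "m = (a + b) / 2" and "h = (b - a) / 2"
  have ab: "a = m - h" "b = m + h" and "0 < h"
    using \<open>a < b\<close> by (auto simp: m_def h_def field_simps)
  have sub: "{a..b} \<subseteq> I"
    using mem_is_interval_1_I[OF assms(1-3)] by auto
  define C where "C = \<bar>f'' a\<bar> + \<bar>f'' b\<bar>"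
  have "\<bar>integral {m-h..m+h} f - 2 * h * f m\<bar> \<le> C * h ^ 3 / 6"
  proof (rule midpoint_rule_error)
    \<comment> \<open>The points \<open>m + t\<close> and \<open>m - t\<close> are mirror images in
      \<open>{a..b}\<close>, so convexity bounds the sum of absolute values and the triangle
      inequality does the rest.\<close>
    fix t assume "t \<in> {0..h}"
    then have "\<bar>f'' (m + t)\<bar> + \<bar>f'' (a + b - (m + t))\<bar> \<le> C"
      unfolding C_def using ab by (intro convex_on_reflect_sum_le[OF assms(8)]) auto
    moreover have "a + b - (m + t) = m - t" by (simp add: ab)
    ultimately show "\<bar>f'' (m + t) + f'' (m - t)\<bar> \<le> C" by simp
  next
    fix x assume "x \<in> {m-h..m+h}"
    then have x: "x \<in> interior I \<union> {a..b}" by (simp add: ab)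
    show "(f has_real_derivative f' x) (at x within {m-h..m+h})"
      by (rule DERIV_subset[OF assms(5)[OF x] sub[unfolded ab]])
    show "(f' has_real_derivative f'' x) (at x within {m-h..m+h})"
      by (rule DERIV_subset[OF assms(6)[OF x] sub[unfolded ab]])
  qed (use \<open>0 < h\<close> in simp)
  \<comment> \<open>Dividing by \<open>2 * h = b - a\<close> turns the integral into a mean; the
    bound becomes \<open>C * h\<^sup>2 / 12\<close>, which is
    \<open>C * (b - a)\<^sup>2 / 48\<close>.\<close>
  then have "\<bar>integral {a..b} f - 2 * h * f m\<bar> / (2 * h) \<le> C * h ^ 3 / 6 / (2 * h)"
    using \<open>0 < h\<close> unfolding ab by (intro divide_right_mono) auto
  also have "\<bar>integral {a..b} f - 2 * h * f m\<bar> / (2 * h)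
      = \<bar>(integral {a..b} f - 2 * h * f m) / (2 * h)\<bar>"
    using \<open>0 < h\<close> by simp
  also have "(integral {a..b} f - 2 * h * f m) / (2 * h)
      = 1 / (b - a) * integral {a..b} f - f ((a + b) / 2)"
    using \<open>0 < h\<close> by (simp add: ab diff_divide_distrib)
  also have "C * h ^ 3 / 6 / (2 * h) = (b - a)\<^sup>2 / 24 * (C / 2)"
    using \<open>0 < h\<close> by (simp add: ab power2_eq_square power3_eq_cube)
  finally show ?thesis by (simp add: C_def)
qed

end
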